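(* Let $T$ be a tree with vertices $v_1,\dots,v_n$ and let $B_T=(L_T+I_n)^{-1}=[b_{ij}]$. Let $v_i$ be a vertex and consider a path $v_{i_0},v_{i_1},\dots,v_{i_k}$ in $T$ with $i_0=i$ and $v_{i_k}$ a pendant vertex (degree $1$). Then \[ b_{i,i_t}\ge 2\,b_{i,i_{t+1}}\qquad (0\le t\le k-1). \]
   Context: $L_T=D-A$ is the Laplacian matrix of $T$ ($A$ adjacency matrix, $D$ diagonal matrix of degrees), with row/column $i$ corresponding to vertex $v_i$; $L_T+I_n$ is positive definite, hence invertible. *)

theory Defs
  imports "HOL-Analysis.Analysis" "Graph_Theory.Graph_Theory"
begin

text \<open>
  A finite simple graph is a term satisfying \<open>graph\<close>: a finite symmetric digraph without loops
  and parallel arcs, in which an edge \<open>uv\<close> is the pair of arcs \<open>u \<rightarrow> v\<close>, \<open>v \<rightarrow> u\<close>. The library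
  predicate \<open>tree\<close> is not usable here, since \<open>pre_digraph.cycle\<close> also holds for the closed walk
  \<open>u \<rightarrow> v \<rightarrow> u\<close> along a single edge. The cycles of length at least 3 are precisely the cycles of
  the undirected graph. \<open>Digraph_Component.connected\<close> includes that there is at least one vertex.
\<close>

definition undirected_tree :: "('a, 'b) pre_digraph \<Rightarrow> bool" where
  "undirected_tree T \<longleftrightarrow>
     graph T \<and> Digraph_Component.connected T \<and>
     \<not> (\<exists>p. pre_digraph.cycle T p \<and> 3 \<le> length p)"

text \<open>Each edge at \<open>x\<close> contributes exactly one arc leaving \<open>x\<close>.\<close>

definition vertex_degree :: "('a, 'b) pre_digraph \<Rightarrow> 'a \<Rightarrow> nat" where
  "vertex_degree T x = out_degree T x"

definition pendant :: "('a, 'b) pre_digraph \<Rightarrow> 'a \<Rightarrow> bool" where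
  "pendant T x \<longleftrightarrow> x \<in> verts T \<and> vertex_degree T x = 1"

text \<open>
  In the following, \<open>v\<close> is an enumeration of the vertices by an index type \<open>'n\<close> with \<open>n\<close> elements;
  row and column \<open>i\<close> belong to the vertex \<open>v i\<close>.
\<close>

definition adjacency_matrix :: "('a, 'b) pre_digraph \<Rightarrow> ('n::finite \<Rightarrow> 'a) \<Rightarrow> real^'n^'n" where
  "adjacency_matrix T v = (\<chi> i j. if v i \<rightarrow>\<^bsub>T\<^esub> v j then 1 else 0)"

definition degree_matrix :: "('a, 'b) pre_digraph \<Rightarrow> ('n::finite \<Rightarrow> 'a) \<Rightarrow> real^'n^'n" where
  "degree_matrix T v = (\<chi> i j. if i = j then real (vertex_degree T (v i)) else 0)"

definition laplacian_matrix :: "('a, 'b) pre_digraph \<Rightarrow> ('n::finite \<Rightarrow> 'a) \<Rightarrow> real^'n^'n" where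
  "laplacian_matrix T v = degree_matrix T v - adjacency_matrix T v"

definition B_matrix :: "('a, 'b) pre_digraph \<Rightarrow> ('n::finite \<Rightarrow> 'a) \<Rightarrow> real^'n^'n" where
  "B_matrix T v = matrix_inv (laplacian_matrix T v + mat 1)"

end

theory Submission
  imports Defs
begin

text \<open>
  Let \<open>x\<close> be the \<open>i\<close>-th row of \<open>B\<^sub>T\<close>, so that \<open>(L\<^sub>T + I) x\<close> is the \<open>i\<close>-th unit vector. By the
  minimum principle, \<open>x \<ge> 0\<close>. Let \<open>u\<close>, \<open>w\<close> be consecutive vertices of the path and let \<open>C\<close> be the
  component of \<open>T - u\<close> containing \<open>w\<close>. As \<open>T\<close> has no cycle, \<open>wu\<close> is the only edge between \<open>C\<close> and
  its complement, and the starting vertex of the path is not in \<open>C\<close>. Summing the equations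
  \<open>x + L\<^sub>T x = 0\<close> over \<open>C\<close>, everything cancels inside \<open>C\<close> and
  \<open>x\<^sub>u - x\<^sub>w = (\<Sum>c\<in>C. x\<^sub>c) \<ge> x\<^sub>w\<close>.
\<close>

section \<open>Weighted difference sums over a finite index type\<close>

text \<open>At an index \<open>m\<close> where \<open>x\<close> is minimal every term
  \<open>a m l * (x m - x l)\<close> is nonpositive, so the inequality at \<open>m\<close> gives
  \<open>0 \<le> x m\<close>.\<close>

lemma minimum_principle:
  fixes x :: "'n::finite \<Rightarrow> real"
  assumes "\<And>j l. 0 \<le> a j l"
    and "\<And>j. 0 \<le> x j + (\<Sum>l\<in>UNIV. a j l * (x j - x l))"
  shows "0 \<le> x j"
proof -
  obtain m where m: "\<And>l. x m \<le> x l"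
    using ex_min_if_finite[of "range x"] by (auto simp: not_less)
  have "(\<Sum>l\<in>UNIV. a m l * (x m - x l)) \<le> 0"
    using assms(1) m by (intro sum_nonpos mult_nonneg_nonpos) auto
  with assms(2)[of m] m[of j] show ?thesis by linarith
qed

lemma sum_antisymmetric:
  fixes f :: "'n \<Rightarrow> 'n \<Rightarrow> real"
  assumes "\<And>j l. f l j = - f j l"
  shows "(\<Sum>j\<in>C. \<Sum>l\<in>C. f j l) = 0"
proof -
  have "(\<Sum>j\<in>C. \<Sum>l\<in>C. f j l) = (\<Sum>l\<in>C. \<Sum>j\<in>C. f j l)"
    by (rule sum.swap)
  also have "\<dots> = (\<Sum>l\<in>C. \<Sum>j\<in>C. - f l j)"
    by (intro sum.cong refl assms)
  finally show ?thesis by (simp add: sum_negf)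
qed

text \<open>Inside \<open>C\<close> the terms cancel by antisymmetry, and among the pairs leading
  out of \<open>C\<close> only \<open>(w, u)\<close> can carry weight.\<close>

lemma sum_laplacian_bridge:
  fixes x :: "'n::finite \<Rightarrow> real"
  assumes sym: "\<And>j l. a j l = a l j"
    and "w \<in> C" "u \<notin> C"
    and bridge: "\<And>j l. j \<in> C \<Longrightarrow> l \<notin> C \<Longrightarrow> (j, l) \<noteq> (w, u) \<Longrightarrow> a j l = 0"
  shows "(\<Sum>j\<in>C. \<Sum>l\<in>UNIV. a j l * (x j - x l)) = a w u * (x w - x u)"
proof -
  let ?f = "\<lambda>j l. a j l * (x j - x l)"
  have "(\<Sum>j\<in>C. \<Sum>l\<in>UNIV. ?f j l) = (\<Sum>j\<in>C. (\<Sum>l\<in>C. ?f j l) + (\<Sum>l\<in>-C. ?f j l))"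
    by (intro sum.cong refl) (subst sum.union_disjoint[symmetric], auto simp: Compl_partition)
  also have "\<dots> = (\<Sum>j\<in>C. \<Sum>l\<in>-C. ?f j l)"
    using sum_antisymmetric[of ?f C] sym by (simp add: sum.distrib algebra_simps)
  also have "\<dots> = (\<Sum>p\<in>C \<times> - C. ?f (fst p) (snd p))"
    by (simp add: sum.cartesian_product case_prod_beta)
  also have "\<dots> = (\<Sum>p\<in>{(w, u)}. ?f (fst p) (snd p))"
  proof (intro sum.mono_neutral_right ballI)
    show "?f (fst p) (snd p) = 0" if "p \<in> C \<times> - C - {(w, u)}" for p
      using that bridge[of "fst p" "snd p"] by auto
  qed (use assms in auto)
  finally show ?thesis by simp
qed

section \<open>Invertibility of the matrix and the rows of its inverse\<close>

lemma matrix_inv_mult_self: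
  fixes M :: "real^'n^'n"
  assumes "invertible M"
  shows "matrix_inv M ** M = mat 1"
  using assms unfolding invertible_def matrix_inv_def by (metis (mono_tags, lifting) someI_ex)

lemma (in graph) adjacency_matrix_commute:
  "adjacency_matrix G v $ j $ l = adjacency_matrix G v $ l $ j"
  using sym_arcs by (auto simp: adjacency_matrix_def symmetric_def sym_def)

text \<open>Without parallel arcs, \<open>head\<close> is injective on the arcs leaving a vertex; as
  \<open>v\<close> is a bijection, these arcs correspond to the indices of the neighbours.\<close>

lemma (in graph) vertex_degree_eq_sum_adjacency_matrix:
  assumes "bij_betw v UNIV (verts G)"
  shows "real (vertex_degree G (v j)) = (\<Sum>l\<in>UNIV. adjacency_matrix G v $ j $ l)"
proof -
  have "inj_on (head G) (out_arcs G (v j))"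
    by (auto simp: inj_on_def out_arcs_def arc_to_ends_def intro!: no_multi_arcs)
  then have "card (out_arcs G (v j)) = card (head G ` out_arcs G (v j))"
    by (simp add: card_image)
  also have "head G ` out_arcs G (v j) = v ` {l. v j \<rightarrow>\<^bsub>G\<^esub> v l}"
  proof -
    have "head G ` out_arcs G (v j) = {y. v j \<rightarrow>\<^bsub>G\<^esub> y}"
      by (force simp: out_arcs_def arcs_ends_conv)
    also have "\<dots> \<subseteq> range v"
      using assms adj_in_verts(2) by (auto simp: bij_betw_def)
    then have "{y. v j \<rightarrow>\<^bsub>G\<^esub> y} = v ` {l. v j \<rightarrow>\<^bsub>G\<^esub> v l}"
      by auto
    finally show ?thesis .
  qed
  also have "card \<dots> = card {l. v j \<rightarrow>\<^bsub>G\<^esub> v l}"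
    using assms by (intro card_image) (auto simp: bij_betw_def inj_on_def)
  finally show ?thesis
    by (simp add: vertex_degree_def out_degree_def adjacency_matrix_def sum.If_cases)
qed

lemma (in graph) laplacian_plus_identity_mult:
  assumes "bij_betw v UNIV (verts G)"
  shows "((laplacian_matrix G v + mat 1) *v x) $ j =
    x $ j + (\<Sum>l\<in>UNIV. adjacency_matrix G v $ j $ l * (x $ j - x $ l))"
proof -
  \<comment> \<open>The diagonal entry becomes a term supported at \<open>l = j\<close>, so that one
    sum covers the whole row.\<close>
  have "((laplacian_matrix G v + mat 1) *v x) $ j =
      (\<Sum>l\<in>UNIV. (if l = j then (real (vertex_degree G (v j)) + 1) * x $ j else 0)
        - adjacency_matrix G v $ j $ l * x $ l)"
    unfolding matrix_vector_mult_def
    by (auto simp: laplacian_matrix_def degree_matrix_def mat_def algebra_simps intro!: sum.cong)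
  also have "\<dots> = (real (vertex_degree G (v j)) + 1) * x $ j
      - (\<Sum>l\<in>UNIV. adjacency_matrix G v $ j $ l * x $ l)"
    by (simp add: sum_subtractf)
  finally show ?thesis
    by (simp add: vertex_degree_eq_sum_adjacency_matrix[OF assms] right_diff_distrib
        distrib_right sum_subtractf sum_distrib_right)
qed

text \<open>The kernel is trivial: the minimum principle applies to a kernel vector \<open>x\<close>
  and to \<open>- x\<close>.\<close>

lemma (in graph) invertible_laplacian_plus_identity:
  assumes "bij_betw v UNIV (verts G)"
  shows "invertible (laplacian_matrix G v + mat 1)"
proof -
  let ?M = "laplacian_matrix G v + mat 1"
  have nonneg: "0 \<le> x $ j" if "?M *v x = 0" for x j
    using laplacian_plus_identity_mult[OF assms, of x] that
    by (rule_tac minimum_principle[where x = "\<lambda>j. x $ j"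
          and a = "\<lambda>j l. adjacency_matrix G v $ j $ l"])
      (simp_all add: adjacency_matrix_def)
  have "x = 0" if "?M *v x = 0" for x
  proof -
    have "?M *v (- x) = 0"
      using that matrix_vector_mult_diff_distrib[of ?M 0 x] by simp
    then show ?thesis
      using nonneg[OF that] nonneg[of "- x"] by (force simp: vec_eq_iff intro: antisym)
  qed
  then show ?thesis
    by (simp add: invertible_left_inverse matrix_left_invertible_ker)
qed

text \<open>A left inverse pairs rows of \<open>B_matrix G v\<close> with columns of
  \<open>?M\<close>; since \<open>?M\<close> is symmetric, this is a linear system for the
  row.\<close>

lemma (in graph) B_matrix_row:
  assumes "bij_betw v UNIV (verts G)"
  shows "B_matrix G v $ i $ j
      + (\<Sum>l\<in>UNIV. adjacency_matrix G v $ j $ l * (B_matrix G v $ i $ j - B_matrix G v $ i $ l))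
    = (if j = i then 1 else 0)"
proof -
  let ?M = "laplacian_matrix G v + mat 1"
  have sym: "?M $ j $ l = ?M $ l $ j" for j l
    using adjacency_matrix_commute[of v j l]
    by (simp add: laplacian_matrix_def degree_matrix_def mat_def)
  have "(?M *v (B_matrix G v $ i)) $ j = (\<Sum>l\<in>UNIV. ?M $ j $ l * B_matrix G v $ i $ l)"
    by (simp add: matrix_vector_mult_def)
  also have "\<dots> = (\<Sum>l\<in>UNIV. B_matrix G v $ i $ l * ?M $ l $ j)"
    by (intro sum.cong refl) (simp only: sym[of j] mult.commute)
  also have "\<dots> = (B_matrix G v ** ?M) $ i $ j"
    by (simp add: matrix_matrix_mult_def)
  also have "\<dots> = (if j = i then 1 else 0)"
    using matrix_inv_mult_self[OF invertible_laplacian_plus_identity[OF assms]]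
    by (simp add: B_matrix_def mat_def)
  finally show ?thesis
    by (simp add: laplacian_plus_identity_mult[OF assms])
qed

lemma (in graph) B_matrix_nonneg:
  assumes "bij_betw v UNIV (verts G)"
  shows "0 \<le> B_matrix G v $ i $ j"
  by (rule minimum_principle[where x = "\<lambda>j. B_matrix G v $ i $ j"
        and a = "\<lambda>j l. adjacency_matrix G v $ j $ l"])
    (simp_all add: B_matrix_row[OF assms], simp add: adjacency_matrix_def)

section \<open>Branches of a tree at a vertex\<close>

text \<open>The two arcs at \<open>u\<close> close \<open>p\<close> to a cycle. As
  \<open>w \<noteq> c\<close>, the path \<open>p\<close> has an arc, which rules out the closed walk
  along a single edge.\<close>

lemma (in wf_digraph) cycle_through_vertex:
  assumes "u \<rightarrow>\<^bsub>G\<^esub> w" "apath w p c" "c \<rightarrow>\<^bsub>G\<^esub> u" "u \<notin> set (awalk_verts w p)" "w \<noteq> c"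
  shows "\<exists>q. cycle q \<and> 3 \<le> length q"
proof -
  obtain e f where e: "e \<in> arcs G" "tail G e = u" "head G e = w"
    and f: "f \<in> arcs G" "tail G f = c" "head G f = u"
    using assms by (auto simp: arcs_ends_conv)
  have p: "awalk w p c" "distinct (awalk_verts w p)"
    using assms by (auto simp: apath_def)
  then have "p \<noteq> []"
    using \<open>w \<noteq> c\<close> by (auto simp: awalk_Nil_iff)
  have walk: "awalk w (p @ [f]) u"
    using p f by (auto simp: awalk_simps)
  then have "awalk_verts w (p @ [f]) = awalk_verts w p @ [u]"
    using p f by (auto simp: awalk_verts_append)
  with walk e p assms(4) have "cycle (e # p @ [f])"
    unfolding cycle_def by (intro exI[of _ u]) (auto simp: awalk_Cons_iff)
  with \<open>p \<noteq> []\<close> show ?thesis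
    by (intro exI[of _ "e # p @ [f]"]) (cases p, auto)
qed

text \<open>\<open>C\<close> consists of the vertices reachable from \<open>w\<close> once
  \<open>u\<close> is deleted. A second neighbour of \<open>u\<close> in \<open>C\<close> would
  yield a cycle through \<open>u\<close>.\<close>

lemma undirected_tree_branch:
  assumes "undirected_tree T" "u \<rightarrow>\<^bsub>T\<^esub> w"
  obtains C where "w \<in> C" "u \<notin> C"
    "\<And>c d. c \<in> C \<Longrightarrow> c \<rightarrow>\<^bsub>T\<^esub> d \<Longrightarrow> d \<noteq> u \<Longrightarrow> d \<in> C"
    "\<And>c. c \<in> C \<Longrightarrow> c \<rightarrow>\<^bsub>T\<^esub> u \<Longrightarrow> c = w"
proof -
  interpret graph T using assms(1) by (simp add: undirected_tree_def)
  define H where "H = del_vert u"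
  interpret H: wf_digraph H unfolding H_def by (rule wf_digraph_del_vert)
  have H: "verts H = verts T - {u}" "tail H = tail T" "head H = head T"
    "arcs H = {a \<in> arcs T. tail T a \<noteq> u \<and> head T a \<noteq> u}"
    by (simp_all add: H_def del_vert_simps)
  \<comment> \<open>Deleting \<open>u\<close> keeps the tail and head maps, so paths of
    \<open>H\<close> can be read as paths of \<open>T\<close>.\<close>
  have verts_eq: "H.awalk_verts a p = awalk_verts a p" for a p
    by (induction p arbitrary: a) (simp_all add: H)
  have cas_eq: "H.cas a p b = cas a p b" for a p b
    by (induction p arbitrary: a) (simp_all add: H)
  define C where "C = {c. w \<rightarrow>\<^sup>*\<^bsub>H\<^esub> c}"
  have u_notin: "u \<notin> verts H"
    by (simp add: H)
  show thesis
  proof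
    have "w \<noteq> u"
      using assms(2) no_loops by (metis reachableE)
    then show "w \<in> C"
      using adj_in_verts(2)[OF assms(2)] by (auto simp: C_def H)
    show "u \<notin> C"
      using H.reachable_in_verts(2) u_notin by (auto simp: C_def)
  next
    fix c d assume c: "c \<in> C" "c \<rightarrow>\<^bsub>T\<^esub> d" "d \<noteq> u"
    then have "c \<noteq> u"
      using H.reachable_in_verts(2) u_notin by (auto simp: C_def)
    with c have "c \<rightarrow>\<^bsub>H\<^esub> d"
      by (auto simp: arcs_ends_conv H)
    with c show "d \<in> C"
      unfolding C_def using H.reachable_adj_trans by blast
  next
    fix c assume c: "c \<in> C" "c \<rightarrow>\<^bsub>T\<^esub> u"
    then obtain p where p: "H.apath w p c"
      by (auto simp: C_def H.reachable_apath)
    have "apath w p c"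
      using p by (auto simp: H.apath_def apath_def H.awalk_def awalk_def verts_eq cas_eq) (auto simp: H)
    moreover have "u \<notin> set (awalk_verts w p)"
      using p u_notin H.awalk_verts_in_verts[of w p u]
      by (auto simp: H.apath_def H.awalk_def verts_eq)
    ultimately show "c = w"
      using cycle_through_vertex[OF assms(2) _ c(2)] assms(1) by (auto simp: undirected_tree_def)
  qed
qed

lemma vwalk_map_upt_adjacent:
  assumes "vwalk (map f [0..<Suc k]) T" "t < k"
  shows "f t \<rightarrow>\<^bsub>T\<^esub> f (Suc t)"
proof -
  \<comment> \<open>The required pair is the arc joining the two pieces of this split.\<close>
  have "[0..<Suc k] = [0..<Suc t] @ [Suc t..<Suc k]"
    using assms(2) upt_add_eq_append[of 0 "Suc t" "k - t"] by simp
  then have "(f t, f (Suc t)) \<in> set (vwalk_arcs (map f [0..<Suc k]))"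
    using assms(2) by (simp add: vwalk_arcs_append hd_map del: upt_Suc) (simp add: hd_map)
  with assms(1) show ?thesis by (auto simp: vwalk_def)
qed

text \<open>A path starting in \<open>C\<close> stays there until it meets \<open>f t\<close>. The
  vertex just before \<open>f t\<close> would then equal \<open>f (Suc t)\<close>, against
  injectivity.\<close>

lemma path_avoids_branch:
  assumes adj: "\<And>s. s < Suc t \<Longrightarrow> f s \<rightarrow>\<^bsub>T\<^esub> f (Suc s)"
    and inj: "inj_on f {..Suc t}"
    and "f t \<notin> C"
    and closed: "\<And>c d. c \<in> C \<Longrightarrow> c \<rightarrow>\<^bsub>T\<^esub> d \<Longrightarrow> d \<noteq> f t \<Longrightarrow> d \<in> C"
    and unique: "\<And>c. c \<in> C \<Longrightarrow> c \<rightarrow>\<^bsub>T\<^esub> f t \<Longrightarrow> c = f (Suc t)"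
  shows "f 0 \<notin> C"
proof
  assume "f 0 \<in> C"
  have "f s \<in> C" if "s < t" for s
    using that
  proof (induction s)
    case (Suc s)
    moreover have "f (Suc s) \<noteq> f t"
      using Suc.prems inj_onD[OF inj, of "Suc s" t] by auto
    ultimately show ?case
      using closed adj[of s] by auto
  qed (simp add: \<open>f 0 \<in> C\<close>)
  moreover obtain s where s: "t = Suc s"
    using \<open>f 0 \<in> C\<close> \<open>f t \<notin> C\<close> by (cases t) auto
  ultimately have "f s = f (Suc t)"
    using unique adj[of s] by simp
  with inj_onD[OF inj, of s "Suc t"] s show False by simp
qed

theorem theorem3p3:
  fixes T :: "('a, 'b) pre_digraph"
    and v :: "'n::finite \<Rightarrow> 'a"
    and i :: 'n
    and \<iota> :: "nat \<Rightarrow> 'n"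
    and k :: nat
  assumes "undirected_tree T"
    and "bij_betw v UNIV (verts T)"
    and "vpath (map (\<lambda>t. v (\<iota> t)) [0..<Suc k]) T"
    and "\<iota> 0 = i"
    and "pendant T (v (\<iota> k))"
  shows "\<forall>t<k. B_matrix T v $ i $ \<iota> t \<ge> 2 * B_matrix T v $ i $ \<iota> (Suc t)"
proof (intro allI impI)
  fix t assume "t < k"
  interpret graph T using assms(1) by (simp add: undirected_tree_def)
  let ?f = "\<lambda>t. v (\<iota> t)"
  let ?a = "\<lambda>j l. adjacency_matrix T v $ j $ l"
  let ?x = "\<lambda>j. B_matrix T v $ i $ j"
  have adj: "?f s \<rightarrow>\<^bsub>T\<^esub> ?f (Suc s)" if "s < k" for s
    using vwalk_map_upt_adjacent[of ?f k T s] that assms(3) by (auto simp: vpath_def)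
  have "inj_on ?f {0..<Suc k}"
    using assms(3) by (auto simp: vpath_def distinct_map simp del: upt_Suc)
  then have inj: "inj_on ?f {..Suc t}"
    by (rule inj_on_subset) (use \<open>t < k\<close> in auto)
  obtain C where C: "?f (Suc t) \<in> C" "?f t \<notin> C"
    "\<And>c d. c \<in> C \<Longrightarrow> c \<rightarrow>\<^bsub>T\<^esub> d \<Longrightarrow> d \<noteq> ?f t \<Longrightarrow> d \<in> C"
    "\<And>c. c \<in> C \<Longrightarrow> c \<rightarrow>\<^bsub>T\<^esub> ?f t \<Longrightarrow> c = ?f (Suc t)"
    using undirected_tree_branch[OF assms(1) adj[OF \<open>t < k\<close>]] by metis
  have "?f 0 \<notin> C"
    by (rule path_avoids_branch[where f = ?f, OF _ inj C(2-4)])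
      (use adj \<open>t < k\<close> in simp_all)
  then have "v i \<notin> C"
    using assms(4) by simp
  have v_eq: "v j = v l \<longleftrightarrow> j = l" for j l
    using assms(2) by (auto simp: bij_betw_def inj_on_def)
  \<comment> \<open>The path gives the arc leaving \<open>?f t\<close>; symmetry supplies the entry
    seen from the branch.\<close>
  have "?a (\<iota> (Suc t)) (\<iota> t) = 1"
    using adjacency_matrix_commute[of v "\<iota> t" "\<iota> (Suc t)"] adj[OF \<open>t < k\<close>]
    by (simp add: adjacency_matrix_def)
  moreover have "?a j l = 0" if "v j \<in> C" "v l \<notin> C" "(j, l) \<noteq> (\<iota> (Suc t), \<iota> t)" for j l
    using C(3)[of "v j" "v l"] C(4)[of "v j"] that v_eq by (auto simp: adjacency_matrix_def)
  ultimately have "(\<Sum>j\<in>v -` C. \<Sum>l\<in>UNIV. ?a j l * (?x j - ?x l)) = ?x (\<iota> (Suc t)) - ?x (\<iota> t)"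
    using sum_laplacian_bridge[of ?a "\<iota> (Suc t)" "v -` C" "\<iota> t" ?x] C(1,2)
      adjacency_matrix_commute[of v] by auto
  \<comment> \<open>The only equation with right-hand side 1 is that of \<open>i\<close>, whose
    vertex lies outside \<open>C\<close>.\<close>
  moreover have "(\<Sum>j\<in>v -` C. ?x j + (\<Sum>l\<in>UNIV. ?a j l * (?x j - ?x l))) = 0"
    using \<open>v i \<notin> C\<close> B_matrix_row[OF assms(2), of i] by (intro sum.neutral) auto
  ultimately have "?x (\<iota> t) - ?x (\<iota> (Suc t)) = (\<Sum>j\<in>v -` C. ?x j)"
    by (simp add: sum.distrib)
  also have "\<dots> \<ge> ?x (\<iota> (Suc t))"
    using C(1) B_matrix_nonneg[OF assms(2)] by (intro member_le_sum) auto
  finally show "2 * ?x (\<iota> (Suc t)) \<le> ?x (\<iota> t)" by simp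
qed

end
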